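(* Let $I$ be an arbitrary (possibly infinite) index set and let $M=\prod_{i\in I}M_i$ be a product of nontrivial monoids with zero. The following conditions are equivalent: (i) $\mathrm{CCE}(M_i)=\{0,1\}$ for every $i\in I$; (ii) the coatoms of $\mathrm{CCE}(M)$ are precisely the elements $\varepsilon_i$ for $i\in I$; (iii) the coordinate factors are precisely the stabilizers of the coatoms of $\mathrm{CCE}(M)$, i.e. $\{\iota_i(M_i): i\in I\}=\{\mathrm{Stab}_M(e): e\text{ is a coatom of }\mathrm{CCE}(M)\}$; (iv) the atoms of $\mathrm{CCE}(M)$ are precisely the elements $\delta_i$ for $i\in I$; (v) the coordinate cofactors are precisely the stabilizers of the atoms of $\mathrm{CCE}(M)$, i.e. $\{\pi_i^{-1}(\{1\}): i\in I\}=\{\mathrm{Stab}_M(e): e\text{ is an atom of }\mathrm{CCE}(M)\}$.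
   Context: A monoid with zero is a monoid with an absorbing element $0$ ($0x=x0=0$ for all $x$); it is nontrivial if it has more than one element (equivalently $0\neq 1$). For a monoid $M$, $\mathrm{CE}(M)=\{e\in M: e^2=e,\ ex=xe\ \text{for all }x\in M\}$ is the set of central idempotents, partially ordered by $e\le f\iff ef=e$. If $M$ has a zero, $e\in\mathrm{CE}(M)$ is complemented if there is $f\in\mathrm{CE}(M)$ such that $ef=0$ and $1$ is the unique common upper bound of $e$ and $f$ in $\mathrm{CE}(M)$; $\mathrm{CCE}(M)$ denotes the set of complemented central idempotents, with the order induced from $\mathrm{CE}(M)$ (least element $0$, greatest element $1$). A coatom of a bounded poset is a maximal element among those strictly below the greatest element; an atom is a minimal element among those strictly above the least element. For $m\in M$, $\mathrm{Stab}_M(m)=\{x\in M: mx=m\}$. In $M=\prod_{i\in I}M_i$ (coordinatewise multiplication), $\varepsilon_i$ is the element with $i$-th coordinate $0$ and all other coordinates $1$; $\delta_i$ is the element with $i$-th coordinate $1$ and all other coordinates $0$; $\iota_i:M_i\to M$ sends $x$ to the tuple with $i$-th coordinate $x$ and all other coordinates $1$; $\pi_i:M\to M_i$ is the $i$-th projection. *)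

theory Defs
  imports "HOL-Algebra.Product_Groups" "HOL-Algebra.Lattice"
begin

definition is_zero :: "('a, 'm) monoid_scheme \<Rightarrow> 'a \<Rightarrow> bool"
  where "is_zero M z \<longleftrightarrow> z \<in> carrier M \<and> (\<forall>x\<in>carrier M. z \<otimes>\<^bsub>M\<^esub> x = z \<and> x \<otimes>\<^bsub>M\<^esub> z = z)"

definition mzero :: "('a, 'm) monoid_scheme \<Rightarrow> 'a"
  where "mzero M = (THE z. is_zero M z)"

locale monoid_with_zero = monoid M for M (structure) +
  assumes zero_exists: "\<exists>z. is_zero M z"

locale nontrivial_monoid_with_zero = monoid_with_zero +
  assumes nontrivial: "\<exists>x\<in>carrier M. \<exists>y\<in>carrier M. x \<noteq> y"

context monoid_with_zero
begin

lemma is_zero_mzero: "is_zero M (mzero M)"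
  unfolding mzero_def
proof (rule theI')
  show "\<exists>!z. is_zero M z"
    using zero_exists unfolding is_zero_def by metis
qed

lemma mzero_closed [simp, intro]: "mzero M \<in> carrier M"
  and mzero_left [simp]: "x \<in> carrier M \<Longrightarrow> mzero M \<otimes> x = mzero M"
  and mzero_right [simp]: "x \<in> carrier M \<Longrightarrow> x \<otimes> mzero M = mzero M"
  using is_zero_mzero unfolding is_zero_def by auto

end

lemma mzero_eqI: "is_zero M z \<Longrightarrow> mzero M = z"
  unfolding mzero_def is_zero_def by (rule the_equality) metis+

definition CE :: "('a, 'm) monoid_scheme \<Rightarrow> 'a set"
  where "CE M = {e \<in> carrier M. e \<otimes>\<^bsub>M\<^esub> e = e \<and> (\<forall>x\<in>carrier M. e \<otimes>\<^bsub>M\<^esub> x = x \<otimes>\<^bsub>M\<^esub> e)}"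

definition CE_poset :: "('a, 'm) monoid_scheme \<Rightarrow> 'a gorder"
  where "CE_poset M = \<lparr>carrier = CE M, eq = (=), le = (\<lambda>e f. e \<otimes>\<^bsub>M\<^esub> f = e)\<rparr>"

definition complemented :: "('a, 'm) monoid_scheme \<Rightarrow> 'a \<Rightarrow> bool"
  where "complemented M e \<longleftrightarrow>
    (\<exists>f\<in>CE M. e \<otimes>\<^bsub>M\<^esub> f = mzero M \<and> Upper (CE_poset M) {e, f} = {\<one>\<^bsub>M\<^esub>})"

definition CCE :: "('a, 'm) monoid_scheme \<Rightarrow> 'a set"
  where "CCE M = {e \<in> CE M. complemented M e}"

definition CCE_poset :: "('a, 'm) monoid_scheme \<Rightarrow> 'a gorder"
  where "CCE_poset M = (CE_poset M)\<lparr>carrier := CCE M\<rparr>"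

text \<open>
  The sets of coatoms and atoms are meant for bounded posets only: \<^const>\<open>top\<close> and
  \<^const>\<open>bottom\<close> are unspecified when there is no greatest or least element. The
  lemmas below show that \<open>CCE_poset M\<close> is bounded by the zero and the unit.
\<close>

definition coatoms :: "('a, 'o) gorder_scheme \<Rightarrow> 'a set"
  where "coatoms L = {c \<in> carrier L. c \<sqsubset>\<^bsub>L\<^esub> \<top>\<^bsub>L\<^esub> \<and>
    \<not> (\<exists>d\<in>carrier L. c \<sqsubset>\<^bsub>L\<^esub> d \<and> d \<sqsubset>\<^bsub>L\<^esub> \<top>\<^bsub>L\<^esub>)}"

definition atoms :: "('a, 'o) gorder_scheme \<Rightarrow> 'a set"
  where "atoms L = {a \<in> carrier L. \<bottom>\<^bsub>L\<^esub> \<sqsubset>\<^bsub>L\<^esub> a \<and>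
    \<not> (\<exists>d\<in>carrier L. \<bottom>\<^bsub>L\<^esub> \<sqsubset>\<^bsub>L\<^esub> d \<and> d \<sqsubset>\<^bsub>L\<^esub> a)}"

context monoid_with_zero
begin

lemma CE_closed: "e \<in> CE M \<Longrightarrow> e \<in> carrier M"
  and CE_idem: "e \<in> CE M \<Longrightarrow> e \<otimes> e = e"
  and CE_central: "e \<in> CE M \<Longrightarrow> x \<in> carrier M \<Longrightarrow> e \<otimes> x = x \<otimes> e"
  unfolding CE_def by blast+

lemma CE_order_antisym:
  assumes "x \<in> CE M" "y \<in> CE M" "x \<otimes> y = x" "y \<otimes> x = y"
  shows "x = y"
  using CE_central[OF assms(1) CE_closed[OF assms(2)]] assms(3,4) by simp

lemma CE_order_trans:
  assumes "x \<in> CE M" "y \<in> CE M" "z \<in> CE M" "x \<otimes> y = x" "y \<otimes> z = y"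
  shows "x \<otimes> z = x"
  using m_assoc[OF assms(1-3)[THEN CE_closed]] assms(4,5) by simp

lemma partial_order_on_CE:
  assumes "A \<subseteq> CE M"
  shows "partial_order ((CE_poset M)\<lparr>carrier := A\<rparr>)"
proof (unfold_locales, goal_cases)
  case (1 x) then show ?case by (simp add: CE_poset_def)
next
  case (2 x y) then show ?case by (simp add: CE_poset_def)
next
  case (3 x y z) then show ?case by (simp add: CE_poset_def)
next
  case (4 x) then show ?case using assms CE_idem by (auto simp: CE_poset_def)
next
  case (5 x y) then show ?case
    using CE_order_antisym[of x y] assms by (auto simp: CE_poset_def)
next
  case (6 x y z) then show ?case
    using CE_order_trans[of x y z] assms by (auto simp: CE_poset_def)
next
  case (7 x y z w) then show ?case by (simp add: CE_poset_def)
next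
  case 8 then show ?case by (simp add: CE_poset_def)
qed

lemma CE_partial_order: "partial_order (CE_poset M)"
  using partial_order_on_CE[of "CE M"] by (simp add: CE_poset_def)

lemma CCE_partial_order: "partial_order (CCE_poset M)"
  unfolding CCE_poset_def by (rule partial_order_on_CE) (auto simp: CCE_def)

lemma CE_memI: "\<one> \<in> CE M" "mzero M \<in> CE M"
  by (simp_all add: CE_def)

lemma CCE_memI: "\<one> \<in> CCE M" "mzero M \<in> CCE M"
proof -
  have "u = \<one>" if "u \<in> CE M" "\<one> \<otimes> u = \<one>" for u
    using that CE_closed[OF that(1)] by simp
  then have U: "Upper (CE_poset M) {\<one>, mzero M} = {\<one>}"
    using CE_memI by (auto simp: Upper_def CE_poset_def)
  show "\<one> \<in> CCE M"
    unfolding CCE_def complemented_def using CE_memI U by force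
  have "Upper (CE_poset M) {mzero M, \<one>} = {\<one>}"
    using U by (simp add: insert_commute)
  then show "mzero M \<in> CCE M"
    unfolding CCE_def complemented_def using CE_memI by force
qed

lemma CCE_top: "\<top>\<^bsub>CCE_poset M\<^esub> = \<one>"
proof -
  have g: "greatest (CCE_poset M) \<one> (carrier (CCE_poset M))"
    using CCE_memI CE_closed
    by (auto simp: greatest_def CCE_poset_def CE_poset_def CCE_def)
  show ?thesis
    unfolding top_def
    by (rule some_equality, rule g) (rule partial_order.greatest_unique[OF CCE_partial_order _ g])
qed

lemma CCE_bottom: "\<bottom>\<^bsub>CCE_poset M\<^esub> = mzero M"
proof -
  have g: "least (CCE_poset M) (mzero M) (carrier (CCE_poset M))"
    using CCE_memI CE_closed
    by (auto simp: least_def CCE_poset_def CE_poset_def CCE_def)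
  show ?thesis
    unfolding bottom_def
    by (rule some_equality, rule g) (rule partial_order.least_unique[OF CCE_partial_order _ g])
qed

end

definition Stab :: "('a, 'm) monoid_scheme \<Rightarrow> 'a \<Rightarrow> 'a set"
  where "Stab M m = {x \<in> carrier M. m \<otimes>\<^bsub>M\<^esub> x = m}"

text \<open>
  The library's \<^const>\<open>product_group\<close> is defined for families of arbitrary monoid records;
  its elements are the extensional functions on the index set.
\<close>

abbreviation product_monoid ::
    "'i set \<Rightarrow> ('i \<Rightarrow> ('a, 'm) monoid_scheme) \<Rightarrow> ('i \<Rightarrow> 'a) monoid"
  where "product_monoid \<equiv> product_group"

definition eps :: "'i set \<Rightarrow> ('i \<Rightarrow> ('a, 'm) monoid_scheme) \<Rightarrow> 'i \<Rightarrow> 'i \<Rightarrow> 'a"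
  where "eps I M i = (\<lambda>j\<in>I. if j = i then mzero (M j) else \<one>\<^bsub>M j\<^esub>)"

definition delta :: "'i set \<Rightarrow> ('i \<Rightarrow> ('a, 'm) monoid_scheme) \<Rightarrow> 'i \<Rightarrow> 'i \<Rightarrow> 'a"
  where "delta I M i = (\<lambda>j\<in>I. if j = i then \<one>\<^bsub>M j\<^esub> else mzero (M j))"

definition iota :: "'i set \<Rightarrow> ('i \<Rightarrow> ('a, 'm) monoid_scheme) \<Rightarrow> 'i \<Rightarrow> 'a \<Rightarrow> 'i \<Rightarrow> 'a"
  where "iota I M i x = (\<lambda>j\<in>I. if j = i then x else \<one>\<^bsub>M j\<^esub>)"

definition proj :: "'i \<Rightarrow> ('i \<Rightarrow> 'a) \<Rightarrow> 'a"
  where "proj i x = x i"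

lemma is_zero_product_monoid:
  assumes "\<And>i. i \<in> I \<Longrightarrow> monoid_with_zero (M i)"
  shows "is_zero (product_monoid I M) (\<lambda>i\<in>I. mzero (M i))"
  using assms by (auto simp: is_zero_def monoid_with_zero.mzero_closed PiE_iff
      monoid_with_zero.mzero_left monoid_with_zero.mzero_right intro!: restrict_ext)

lemma monoid_with_zero_product_monoid:
  assumes "\<And>i. i \<in> I \<Longrightarrow> monoid_with_zero (M i)"
  shows "monoid_with_zero (product_monoid I M)"
proof -
  have m: "monoid (M i)" if "i \<in> I" for i
    using assms[OF that] by (rule monoid_with_zero.axioms)
  have "monoid (product_monoid I M)"
  proof (rule monoidI, goal_cases)
    case (3 x y z)
    then show ?case
      by (auto simp: PiE_iff m monoid.m_assoc intro!: restrict_ext)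
  next
    case (4 x)
    then show ?case
      by (auto simp: PiE_iff m monoid.l_one extensional_def)
  next
    case (5 x)
    then show ?case
      by (auto simp: PiE_iff m monoid.r_one extensional_def)
  qed (auto simp: PiE_iff m monoid.m_closed monoid.one_closed)
  moreover have "is_zero (product_monoid I M) (\<lambda>i\<in>I. mzero (M i))"
    using assms by (rule is_zero_product_monoid)
  ultimately show ?thesis
    by (intro monoid_with_zero.intro monoid_with_zero_axioms.intro exI)
qed

definition all_equivalent :: "bool list \<Rightarrow> bool"
  where "all_equivalent Ps \<longleftrightarrow> (\<forall>P\<in>set Ps. \<forall>Q\<in>set Ps. P \<longleftrightarrow> Q)"

end

theory Submission
  imports Defs
begin

text \<open>
  \<open>CE\<close>, and with it \<open>CCE\<close>, commutes with products. Hence the interval between \<open>\<epsilon>\<^sub>i\<close> and \<open>1\<close>, as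
  well as the one between \<open>0\<close> and \<open>\<delta>\<^sub>i\<close>, is a copy of \<open>CCE (M\<^sub>i)\<close>: already the single facts that
  \<open>\<epsilon>\<^sub>i\<close> is a coatom, and that \<open>\<delta>\<^sub>i\<close> is an atom, are equivalent to \<open>CCE (M\<^sub>i) = {0, 1}\<close>. The stabilizers
  of \<open>\<epsilon>\<^sub>i\<close> and \<open>\<delta>\<^sub>i\<close> are the \<open>i\<close>-th factor and cofactor, and conversely a coatom (atom) with
  such a stabilizer must be \<open>\<epsilon>\<^sub>i\<close> (\<open>\<delta>\<^sub>i\<close>).
\<close>

section \<open>Complemented central idempotents of a single monoid\<close>

context monoid_with_zero
begin

lemma CCE_closed: "e \<in> CCE M \<Longrightarrow> e \<in> carrier M"
  using CE_closed unfolding CCE_def by blast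

text \<open>\<open>\<one>\<close> is always a common upper bound, so only its uniqueness has to be
  tested. This elementwise form can be transferred coordinate by coordinate.\<close>

lemma complemented_iff:
  assumes "e \<in> CE M"
  shows "complemented M e \<longleftrightarrow> (\<exists>f\<in>CE M. e \<otimes> f = mzero M \<and>
    (\<forall>u\<in>CE M. e \<otimes> u = e \<longrightarrow> f \<otimes> u = f \<longrightarrow> u = \<one>))"
proof -
  have "Upper (CE_poset M) {e, f} = {\<one>} \<longleftrightarrow>
      (\<forall>u\<in>CE M. e \<otimes> u = e \<longrightarrow> f \<otimes> u = f \<longrightarrow> u = \<one>)" if "f \<in> CE M" for f
    using assms that CE_memI(1) CE_closed r_one
    by (auto simp: Upper_def CE_poset_def)
  then show ?thesis
    unfolding complemented_def by blast
qed

lemma mem_coatoms_CCE_iff: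
  "c \<in> coatoms (CCE_poset M) \<longleftrightarrow> c \<in> CCE M \<and> c \<noteq> \<one> \<and>
    (\<forall>d\<in>CCE M. c \<otimes> d = c \<longrightarrow> d = c \<or> d = \<one>)"
  unfolding coatoms_def lless_def CCE_top
  by (auto simp: CCE_poset_def CE_poset_def CCE_def CE_closed)

lemma mem_atoms_CCE_iff:
  "a \<in> atoms (CCE_poset M) \<longleftrightarrow> a \<in> CCE M \<and> a \<noteq> mzero M \<and>
    (\<forall>d\<in>CCE M. d \<otimes> a = d \<longrightarrow> d = mzero M \<or> d = a)"
  unfolding atoms_def lless_def CCE_bottom
  by (auto simp: CCE_poset_def CE_poset_def CCE_def CE_closed)

end

lemma (in nontrivial_monoid_with_zero) mzero_neq_one: "mzero M \<noteq> \<one>"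
  using nontrivial mzero_left l_one by metis

section \<open>Coordinatewise calculus in the product\<close>

locale nontrivial_monoids_with_zero =
  fixes I :: "'i set" and M :: "'i \<Rightarrow> ('a, 'm) monoid_scheme"
  assumes factors: "i \<in> I \<Longrightarrow> nontrivial_monoid_with_zero (M i)"
begin

abbreviation P where "P \<equiv> product_monoid I M"

text \<open>The counterpart of \<open>iota\<close> that fills the other coordinates with zeros:
  \<open>iota\<close> parametrizes what lies above \<open>eps I M i\<close>, \<open>embed0\<close>
  what lies below \<open>delta I M i\<close>.\<close>

definition embed0 :: "'i \<Rightarrow> 'a \<Rightarrow> 'i \<Rightarrow> 'a"
  where "embed0 i x = (\<lambda>j\<in>I. if j = i then x else mzero (M j))"

lemma factors_with_zero: "i \<in> I \<Longrightarrow> monoid_with_zero (M i)"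
  using factors nontrivial_monoid_with_zero.axioms(1) by blast

sublocale P: monoid_with_zero P
  using factors_with_zero by (rule monoid_with_zero_product_monoid)

lemma factors_simps [simp]:
  assumes "i \<in> I"
  shows "\<one>\<^bsub>M i\<^esub> \<in> carrier (M i)" "mzero (M i) \<in> carrier (M i)"
    "mzero (M i) \<noteq> \<one>\<^bsub>M i\<^esub>" "\<one>\<^bsub>M i\<^esub> \<noteq> mzero (M i)"
    "x \<in> carrier (M i) \<Longrightarrow> \<one>\<^bsub>M i\<^esub> \<otimes>\<^bsub>M i\<^esub> x = x"
    "x \<in> carrier (M i) \<Longrightarrow> x \<otimes>\<^bsub>M i\<^esub> \<one>\<^bsub>M i\<^esub> = x"
    "x \<in> carrier (M i) \<Longrightarrow> mzero (M i) \<otimes>\<^bsub>M i\<^esub> x = mzero (M i)"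
    "x \<in> carrier (M i) \<Longrightarrow> x \<otimes>\<^bsub>M i\<^esub> mzero (M i) = mzero (M i)"
proof -
  interpret N: nontrivial_monoid_with_zero "M i"
    using assms by (rule factors)
  show "\<one>\<^bsub>M i\<^esub> \<in> carrier (M i)" "mzero (M i) \<in> carrier (M i)"
    "mzero (M i) \<noteq> \<one>\<^bsub>M i\<^esub>" "\<one>\<^bsub>M i\<^esub> \<noteq> mzero (M i)"
    "x \<in> carrier (M i) \<Longrightarrow> \<one>\<^bsub>M i\<^esub> \<otimes>\<^bsub>M i\<^esub> x = x"
    "x \<in> carrier (M i) \<Longrightarrow> x \<otimes>\<^bsub>M i\<^esub> \<one>\<^bsub>M i\<^esub> = x"
    "x \<in> carrier (M i) \<Longrightarrow> mzero (M i) \<otimes>\<^bsub>M i\<^esub> x = mzero (M i)"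
    "x \<in> carrier (M i) \<Longrightarrow> x \<otimes>\<^bsub>M i\<^esub> mzero (M i) = mzero (M i)"
    using N.mzero_neq_one by auto
qed

lemma mzero_P: "mzero P = (\<lambda>i\<in>I. mzero (M i))"
  using factors_with_zero by (intro mzero_eqI is_zero_product_monoid)

text \<open>Products in \<open>P\<close> are extensional by construction, so extensionality is asked
  of \<open>z\<close> alone. With \<open>z = x\<close> this says that the order of
  \<open>CE P\<close> is coordinatewise.\<close>

lemma mult_eq_iff:
  assumes "z \<in> extensional I"
  shows "x \<otimes>\<^bsub>P\<^esub> y = z \<longleftrightarrow> (\<forall>i\<in>I. x i \<otimes>\<^bsub>M i\<^esub> y i = z i)"
  using assms by (auto simp: fun_eq_iff extensional_def)

lemma iota_apply: "i \<in> I \<Longrightarrow> iota I M i x i = x"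
  by (simp add: iota_def)

lemma embed0_apply: "i \<in> I \<Longrightarrow> embed0 i x i = x"
  by (simp add: embed0_def)

lemma iota_closed: "x \<in> carrier (M i) \<Longrightarrow> iota I M i x \<in> carrier P"
  by (auto simp: iota_def)

section \<open>Central idempotents and their complements in a product\<close>

lemma CE_P: "CE P = (\<Pi>\<^sub>E i\<in>I. CE (M i))"
proof (intro Set.set_eqI iffI)
  fix e assume e: "e \<in> CE P"
  have ext: "e \<in> extensional I" and cl: "\<And>i. i \<in> I \<Longrightarrow> e i \<in> carrier (M i)"
    using P.CE_closed[OF e] by (auto simp: PiE_iff)
  have "e i \<in> CE (M i)" if i: "i \<in> I" for i
  proof -
    have "e i \<otimes>\<^bsub>M i\<^esub> e i = e i"
      using P.CE_idem[OF e] i unfolding mult_eq_iff[OF ext] by blast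
    moreover have "e i \<otimes>\<^bsub>M i\<^esub> x = x \<otimes>\<^bsub>M i\<^esub> e i" if x: "x \<in> carrier (M i)" for x
      \<comment> \<open>Centrality of \<open>e i\<close> is tested by commuting \<open>e\<close>
        with \<open>iota I M i x\<close> and reading off coordinate \<open>i\<close>.\<close>
      using fun_cong[OF P.CE_central[OF e iota_closed[OF x]], of i] i by (simp add: iota_def)
    ultimately show ?thesis
      using cl[OF i] unfolding CE_def by blast
  qed
  with ext show "e \<in> (\<Pi>\<^sub>E i\<in>I. CE (M i))"
    by (simp add: PiE_iff)
next
  fix e assume "e \<in> (\<Pi>\<^sub>E i\<in>I. CE (M i))"
  then have ext: "e \<in> extensional I" and e: "\<And>i. i \<in> I \<Longrightarrow> e i \<in> CE (M i)"
    by (auto simp: PiE_iff)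
  have "e \<otimes>\<^bsub>P\<^esub> e = e"
    unfolding mult_eq_iff[OF ext] using e unfolding CE_def by blast
  moreover have "e \<otimes>\<^bsub>P\<^esub> x = x \<otimes>\<^bsub>P\<^esub> e" if "x \<in> carrier P" for x
    using that e by (auto simp: PiE_iff intro!: restrict_ext monoid_with_zero.CE_central[OF factors_with_zero])
  moreover have "e \<in> carrier P"
    using ext e by (auto simp: PiE_iff monoid_with_zero.CE_closed[OF factors_with_zero])
  ultimately show "e \<in> CE P"
    unfolding CE_def by blast
qed

lemma CCE_P: "CCE P = (\<Pi>\<^sub>E i\<in>I. CCE (M i))"
proof (intro Set.set_eqI iffI)
  fix e assume "e \<in> CCE P"
  then have e: "e \<in> CE P" and "complemented P e"
    by (auto simp: CCE_def)
  then obtain f where f: "f \<in> CE P" "e \<otimes>\<^bsub>P\<^esub> f = mzero P"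
    and top: "\<And>u. u \<in> CE P \<Longrightarrow> e \<otimes>\<^bsub>P\<^esub> u = e \<Longrightarrow> f \<otimes>\<^bsub>P\<^esub> u = f \<Longrightarrow> u = \<one>\<^bsub>P\<^esub>"
    using P.complemented_iff[OF e] by blast
  have ei: "e i \<in> CE (M i)" and fi: "f i \<in> CE (M i)" if "i \<in> I" for i
    using e f(1) that unfolding CE_P by (auto simp: PiE_iff)
  have ext: "e \<in> extensional I" "f \<in> extensional I"
    using e f(1) unfolding CE_P by (auto simp: PiE_iff)
  have "complemented (M i) (e i)" if i: "i \<in> I" for i
  proof -
    interpret N: monoid_with_zero "M i"
      using i by (rule factors_with_zero)
    have "e i \<otimes>\<^bsub>M i\<^esub> f i = mzero (M i)"
      using fun_cong[OF f(2), of i] i by (simp add: mzero_P)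
    moreover have "u = \<one>\<^bsub>M i\<^esub>"
      if u: "u \<in> CE (M i)" "e i \<otimes>\<^bsub>M i\<^esub> u = e i" "f i \<otimes>\<^bsub>M i\<^esub> u = f i" for u
    proof -
      \<comment> \<open>An upper bound \<open>u\<close> in one factor is lifted by ones elsewhere;
        the lift is above both \<open>e\<close> and \<open>f\<close>, since multiplying by one fixes
        their remaining coordinates.\<close>
      have "iota I M i u \<in> CE P"
        unfolding CE_P using u(1) monoid_with_zero.CE_memI(1)[OF factors_with_zero]
        by (auto simp: iota_def)
      moreover have "e \<otimes>\<^bsub>P\<^esub> iota I M i u = e" "f \<otimes>\<^bsub>P\<^esub> iota I M i u = f"
        unfolding mult_eq_iff[OF ext(1)] mult_eq_iff[OF ext(2)]
        using u ei fi by (auto simp: iota_def CE_def)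
      ultimately have "iota I M i u = \<one>\<^bsub>P\<^esub>"
        by (rule top)
      from fun_cong[OF this, of i] show ?thesis
        using i by (simp add: iota_def)
    qed
    ultimately show ?thesis
      unfolding N.complemented_iff[OF ei[OF i]] using fi[OF i] by blast
  qed
  with ei ext show "e \<in> (\<Pi>\<^sub>E i\<in>I. CCE (M i))"
    by (simp add: CCE_def PiE_iff)
next
  fix e assume e: "e \<in> (\<Pi>\<^sub>E i\<in>I. CCE (M i))"
  then have eP: "e \<in> CE P" and ext: "e \<in> extensional I"
    unfolding CE_P by (auto simp: CCE_def PiE_iff)
  have "\<exists>f\<in>CE (M i). e i \<otimes>\<^bsub>M i\<^esub> f = mzero (M i) \<and>
      (\<forall>u\<in>CE (M i). e i \<otimes>\<^bsub>M i\<^esub> u = e i \<longrightarrow> f \<otimes>\<^bsub>M i\<^esub> u = f \<longrightarrow> u = \<one>\<^bsub>M i\<^esub>)"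
    if "i \<in> I" for i
    using e that monoid_with_zero.complemented_iff[OF factors_with_zero]
    by (auto simp: CCE_def PiE_iff)
  then obtain f where f: "\<And>i. i \<in> I \<Longrightarrow> f i \<in> CE (M i)"
      "\<And>i. i \<in> I \<Longrightarrow> e i \<otimes>\<^bsub>M i\<^esub> f i = mzero (M i)"
    and top: "\<And>i u. i \<in> I \<Longrightarrow> u \<in> CE (M i) \<Longrightarrow> e i \<otimes>\<^bsub>M i\<^esub> u = e i
      \<Longrightarrow> f i \<otimes>\<^bsub>M i\<^esub> u = f i \<Longrightarrow> u = \<one>\<^bsub>M i\<^esub>"
    by metis
  \<comment> \<open>Complements chosen in the single factors are assembled into one of
    \<open>e\<close>; the restriction makes the family extensional.\<close>
  define g where "g = restrict f I"
  have g: "g \<in> CE P" "g \<in> extensional I"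
    unfolding CE_P g_def using f(1) by auto
  have "e \<otimes>\<^bsub>P\<^esub> g = mzero P"
    unfolding mzero_P using f(2) by (auto simp: g_def intro!: restrict_ext)
  moreover have "u = \<one>\<^bsub>P\<^esub>" if "u \<in> CE P" "e \<otimes>\<^bsub>P\<^esub> u = e" "g \<otimes>\<^bsub>P\<^esub> u = g" for u
  proof -
    have "u \<in> extensional I" and "\<And>i. i \<in> I \<Longrightarrow> u i \<in> CE (M i)"
      using that(1) unfolding CE_P by (auto simp: PiE_iff)
    moreover have "e i \<otimes>\<^bsub>M i\<^esub> u i = e i" "f i \<otimes>\<^bsub>M i\<^esub> u i = f i" if "i \<in> I" for i
      using \<open>e \<otimes>\<^bsub>P\<^esub> u = e\<close> \<open>g \<otimes>\<^bsub>P\<^esub> u = g\<close> that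
      unfolding mult_eq_iff[OF ext] mult_eq_iff[OF g(2)] by (auto simp: g_def)
    ultimately show ?thesis
      using top by (auto simp: extensional_def fun_eq_iff)
  qed
  ultimately have "complemented P e"
    unfolding P.complemented_iff[OF eP] using g(1) by blast
  with eP show "e \<in> CCE P"
    by (simp add: CCE_def)
qed

lemma CCE_component:
  assumes "e \<in> CCE P" "i \<in> I"
  shows "e i \<in> CCE (M i)" "e i \<in> carrier (M i)"
  using assms P.CCE_closed by (auto simp: CCE_P PiE_iff)

lemma CCE_extensional: "e \<in> CCE P \<Longrightarrow> e \<in> extensional I"
  unfolding CCE_P by (simp add: PiE_iff)

lemmas CCE_factor_memI [simp] = monoid_with_zero.CCE_memI[OF factors_with_zero]

section \<open>The elements \<open>eps\<close> and \<open>delta\<close> and the intervals they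
  bound\<close>

lemma iota_CCE: "x \<in> CCE (M i) \<Longrightarrow> iota I M i x \<in> CCE P"
  unfolding CCE_P by (auto simp: iota_def)

lemma embed0_CCE: "x \<in> CCE (M i) \<Longrightarrow> embed0 i x \<in> CCE P"
  unfolding CCE_P by (auto simp: embed0_def)

lemma eps_eq_iota: "eps I M i = iota I M i (mzero (M i))"
  by (auto simp: eps_def iota_def intro!: restrict_ext)

lemma delta_eq_embed0: "delta I M i = embed0 i \<one>\<^bsub>M i\<^esub>"
  by (auto simp: delta_def embed0_def intro!: restrict_ext)

lemma eps_CCE: "i \<in> I \<Longrightarrow> eps I M i \<in> CCE P"
  unfolding eps_eq_iota by (rule iota_CCE) simp

lemma delta_CCE: "i \<in> I \<Longrightarrow> delta I M i \<in> CCE P"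
  unfolding delta_eq_embed0 by (rule embed0_CCE) simp

lemma eps_neq_one: "i \<in> I \<Longrightarrow> eps I M i \<noteq> \<one>\<^bsub>P\<^esub>"
  by (auto simp: eps_def fun_eq_iff)

lemma delta_neq_zero: "i \<in> I \<Longrightarrow> delta I M i \<noteq> mzero P"
  by (auto simp: delta_def mzero_P fun_eq_iff)

text \<open>Off \<open>i\<close> the coordinates of \<open>eps I M i\<close> are one and force those
  of \<open>x\<close> to be one; at \<open>i\<close> the zero imposes nothing. The equation
  describes both the interval above \<open>eps I M i\<close> and its stabilizer.\<close>

lemma eps_le_iff:
  assumes "i \<in> I" "x \<in> carrier P"
  shows "eps I M i \<otimes>\<^bsub>P\<^esub> x = eps I M i \<longleftrightarrow> x = iota I M i (x i)"
  using assms by (subst mult_eq_iff)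
    (auto simp: eps_def iota_def PiE_iff fun_eq_iff extensional_def)

text \<open>Off \<open>i\<close> the zeros of \<open>delta I M i\<close> force \<open>x\<close> to
  vanish; at \<open>i\<close> the one imposes nothing.\<close>

lemma le_delta_iff:
  assumes "i \<in> I" "x \<in> carrier P"
  shows "x \<otimes>\<^bsub>P\<^esub> delta I M i = x \<longleftrightarrow> x = embed0 i (x i)"
  using assms by (subst mult_eq_iff)
    (auto simp: delta_def embed0_def PiE_iff fun_eq_iff extensional_def)

section \<open>When \<open>eps\<close> is a coatom and \<open>delta\<close> is an atom\<close>

lemma eps_coatom_iff:
  assumes i: "i \<in> I"
  shows "eps I M i \<in> coatoms (CCE_poset P) \<longleftrightarrow> CCE (M i) = {mzero (M i), \<one>\<^bsub>M i\<^esub>}"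
proof
  assume c: "eps I M i \<in> coatoms (CCE_poset P)"
  have "x = mzero (M i) \<or> x = \<one>\<^bsub>M i\<^esub>" if x: "x \<in> CCE (M i)" for x
  proof -
    \<comment> \<open>The element \<open>iota I M i x\<close> lies above \<open>eps I M i\<close> in
      \<open>CCE P\<close>, so maximality leaves two cases; coordinate \<open>i\<close> then
      recovers \<open>x\<close>.\<close>
    have "iota I M i x = eps I M i \<or> iota I M i x = \<one>\<^bsub>P\<^esub>"
      using c iota_CCE[OF x] eps_le_iff[OF i P.CCE_closed[OF iota_CCE[OF x]]] iota_apply[OF i]
      unfolding P.mem_coatoms_CCE_iff by metis
    then have "iota I M i x i = eps I M i i \<or> iota I M i x i = \<one>\<^bsub>P\<^esub> i"
      by metis
    then show ?thesis
      using i by (simp add: iota_def eps_def)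
  qed
  then show "CCE (M i) = {mzero (M i), \<one>\<^bsub>M i\<^esub>}"
    using i by auto
next
  assume triv: "CCE (M i) = {mzero (M i), \<one>\<^bsub>M i\<^esub>}"
  have "d = eps I M i \<or> d = \<one>\<^bsub>P\<^esub>" if d: "d \<in> CCE P" "eps I M i \<otimes>\<^bsub>P\<^esub> d = eps I M i" for d
  proof -
    have "d = iota I M i (d i)"
      using d eps_le_iff[OF i P.CCE_closed] by blast
    moreover have "iota I M i \<one>\<^bsub>M i\<^esub> = \<one>\<^bsub>P\<^esub>"
      by (auto simp: iota_def intro!: restrict_ext)
    ultimately show ?thesis
      using CCE_component(1)[OF d(1) i] triv eps_eq_iota[of i] by (metis insertE singletonD)
  qed
  then show "eps I M i \<in> coatoms (CCE_poset P)"
    unfolding P.mem_coatoms_CCE_iff using i eps_CCE eps_neq_one by blast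
qed

lemma delta_atom_iff:
  assumes i: "i \<in> I"
  shows "delta I M i \<in> atoms (CCE_poset P) \<longleftrightarrow> CCE (M i) = {mzero (M i), \<one>\<^bsub>M i\<^esub>}"
proof
  assume a: "delta I M i \<in> atoms (CCE_poset P)"
  have "x = mzero (M i) \<or> x = \<one>\<^bsub>M i\<^esub>" if x: "x \<in> CCE (M i)" for x
  proof -
    have "embed0 i x = mzero P \<or> embed0 i x = delta I M i"
      using a embed0_CCE[OF x] le_delta_iff[OF i P.CCE_closed[OF embed0_CCE[OF x]]] embed0_apply[OF i]
      unfolding P.mem_atoms_CCE_iff by metis
    then have "embed0 i x i = mzero P i \<or> embed0 i x i = delta I M i i"
      by metis
    then show ?thesis
      using i by (simp add: embed0_def delta_def mzero_P)
  qed
  then show "CCE (M i) = {mzero (M i), \<one>\<^bsub>M i\<^esub>}"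
    using i by auto
next
  assume triv: "CCE (M i) = {mzero (M i), \<one>\<^bsub>M i\<^esub>}"
  have "d = mzero P \<or> d = delta I M i" if d: "d \<in> CCE P" "d \<otimes>\<^bsub>P\<^esub> delta I M i = d" for d
  proof -
    have "d = embed0 i (d i)"
      using d le_delta_iff[OF i P.CCE_closed] by blast
    moreover have "embed0 i (mzero (M i)) = mzero P"
      by (auto simp: embed0_def mzero_P intro!: restrict_ext)
    ultimately show ?thesis
      using CCE_component(1)[OF d(1) i] triv delta_eq_embed0[of i] by (metis insertE singletonD)
  qed
  then show "delta I M i \<in> atoms (CCE_poset P)"
    unfolding P.mem_atoms_CCE_iff using i delta_CCE delta_neq_zero by blast
qed

text \<open>Here \<open>eps I M i\<close> is not assumed to be a coatom: it is an element of
  \<open>CCE P\<close> other than \<open>\<one>\<close>, and maximality of \<open>c\<close> does the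
  rest.\<close>

lemma coatom_le_epsD:
  assumes "c \<in> coatoms (CCE_poset P)" "i \<in> I" "c \<otimes>\<^bsub>P\<^esub> eps I M i = c"
  shows "c = eps I M i"
  using assms eps_CCE eps_neq_one unfolding P.mem_coatoms_CCE_iff by metis

lemma delta_le_atomD:
  assumes "a \<in> atoms (CCE_poset P)" "i \<in> I" "delta I M i \<otimes>\<^bsub>P\<^esub> a = delta I M i"
  shows "a = delta I M i"
  using assms delta_CCE delta_neq_zero unfolding P.mem_atoms_CCE_iff by metis

section \<open>Determination of all coatoms and atoms\<close>

lemma coatoms_eq_iff:
  "coatoms (CCE_poset P) = {eps I M i | i. i \<in> I} \<longleftrightarrow>
    (\<forall>i\<in>I. CCE (M i) = {mzero (M i), \<one>\<^bsub>M i\<^esub>})"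
proof
  assume triv: "\<forall>i\<in>I. CCE (M i) = {mzero (M i), \<one>\<^bsub>M i\<^esub>}"
  have "\<exists>i\<in>I. c = eps I M i" if c: "c \<in> coatoms (CCE_poset P)" for c
  proof -
    have cP: "c \<in> CCE P" "c \<noteq> \<one>\<^bsub>P\<^esub>"
      using c unfolding P.mem_coatoms_CCE_iff by auto
    \<comment> \<open>Some coordinate of \<open>c\<close> differs from one, hence is zero by
      triviality of that factor; this puts \<open>c\<close> below \<open>eps I M i\<close>.\<close>
    then obtain i where i: "i \<in> I" "c i \<noteq> \<one>\<^bsub>M i\<^esub>"
      using CCE_extensional[OF cP(1)] by (auto simp: fun_eq_iff extensional_def split: if_splits)
    then have "c i = mzero (M i)"
      using CCE_component(1)[OF cP(1)] triv by auto
    then have "c \<otimes>\<^bsub>P\<^esub> eps I M i = c"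
      using CCE_component(2)[OF cP(1)]
      by (subst mult_eq_iff[OF CCE_extensional[OF cP(1)]]) (auto simp: eps_def)
    then show ?thesis
      using coatom_le_epsD[OF c i(1)] i(1) by blast
  qed
  then show "coatoms (CCE_poset P) = {eps I M i | i. i \<in> I}"
    using triv eps_coatom_iff by blast
qed (use eps_coatom_iff in blast)

lemma atoms_eq_iff:
  "atoms (CCE_poset P) = {delta I M i | i. i \<in> I} \<longleftrightarrow>
    (\<forall>i\<in>I. CCE (M i) = {mzero (M i), \<one>\<^bsub>M i\<^esub>})"
proof
  assume triv: "\<forall>i\<in>I. CCE (M i) = {mzero (M i), \<one>\<^bsub>M i\<^esub>}"
  have "\<exists>i\<in>I. a = delta I M i" if a: "a \<in> atoms (CCE_poset P)" for a
  proof -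
    have aP: "a \<in> CCE P" "a \<noteq> mzero P"
      using a unfolding P.mem_atoms_CCE_iff by auto
    \<comment> \<open>Dually, a nonzero coordinate of \<open>a\<close> must be one, which puts
      \<open>delta I M i\<close> below \<open>a\<close>.\<close>
    then obtain i where i: "i \<in> I" "a i \<noteq> mzero (M i)"
      using CCE_extensional[OF aP(1)] unfolding mzero_P
      by (auto simp: fun_eq_iff extensional_def split: if_splits)
    then have "a i = \<one>\<^bsub>M i\<^esub>"
      using CCE_component(1)[OF aP(1)] triv by auto
    then have "delta I M i \<otimes>\<^bsub>P\<^esub> a = delta I M i"
      using CCE_component(2)[OF aP(1)]
      by (subst mult_eq_iff[OF CCE_extensional[OF delta_CCE[OF i(1)]]]) (auto simp: delta_def)
    then show ?thesis
      using delta_le_atomD[OF a i(1)] i(1) by blast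
  qed
  then show "atoms (CCE_poset P) = {delta I M i | i. i \<in> I}"
    using triv delta_atom_iff by blast
qed (use delta_atom_iff in blast)

section \<open>Stabilizers of coatoms and atoms\<close>

lemma Stab_eps:
  assumes i: "i \<in> I"
  shows "Stab P (eps I M i) = iota I M i ` carrier (M i)"
proof (intro Set.set_eqI iffI)
  fix x assume "x \<in> Stab P (eps I M i)"
  then have x: "x \<in> carrier P" "x = iota I M i (x i)"
    using eps_le_iff[OF i] unfolding Stab_def by blast+
  moreover have "x i \<in> carrier (M i)"
    using x(1) i by auto
  ultimately show "x \<in> iota I M i ` carrier (M i)"
    by blast
next
  fix x assume "x \<in> iota I M i ` carrier (M i)"
  then obtain y where y: "y \<in> carrier (M i)" "x = iota I M i y"
    by blast
  then have "x i = y"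
    using i by (simp add: iota_def)
  then show "x \<in> Stab P (eps I M i)"
    using y iota_closed[OF y(1)] eps_le_iff[OF i, of x] by (simp add: Stab_def)
qed

text \<open>Zeros absorb every factor, so only coordinate \<open>i\<close> restricts
  \<open>x\<close>. The case \<open>y = \<one>\<close> gives the cofactor.\<close>

lemma Stab_embed0:
  assumes "i \<in> I" "y \<in> carrier (M i)"
  shows "Stab P (embed0 i y) = {x \<in> carrier P. y \<otimes>\<^bsub>M i\<^esub> x i = y}"
proof -
  have "embed0 i y \<in> extensional I"
    by (simp add: embed0_def)
  from mult_eq_iff[OF this] show ?thesis
    using assms by (auto simp: Stab_def embed0_def PiE_iff)
qed

lemma Stab_delta:
  assumes i: "i \<in> I"
  shows "Stab P (delta I M i) = proj i -` {\<one>\<^bsub>M i\<^esub>} \<inter> carrier P"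
proof -
  have "\<one>\<^bsub>M i\<^esub> \<otimes>\<^bsub>M i\<^esub> x i = x i" if "x \<in> carrier P" for x
    using that i by (auto simp: PiE_iff)
  then show ?thesis
    unfolding delta_eq_embed0 Stab_embed0[OF i factors_simps(1)[OF i]] proj_def
      vimage_def Int_def mem_Collect_eq singleton_iff by metis
qed

text \<open>The factor contains \<open>eps I M i\<close> as the image of zero, so
  \<open>eps I M i\<close> stabilizes \<open>c\<close>, which means that \<open>c\<close> lies below
  it.\<close>

lemma coatom_with_factor_stabilizer:
  assumes i: "i \<in> I" and c: "c \<in> coatoms (CCE_poset P)"
    and Stab: "Stab P c = iota I M i ` carrier (M i)"
  shows "c = eps I M i"
proof (rule coatom_le_epsD[OF c i])
  have "eps I M i \<in> Stab P c"
    unfolding Stab eps_eq_iota using factors_simps(2)[OF i] by (rule imageI)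
  then show "c \<otimes>\<^bsub>P\<^esub> eps I M i = c"
    by (simp add: Stab_def)
qed

text \<open>
  Unlike in the coatom case, minimality of \<open>a\<close> does not give \<open>a = \<delta>\<^sub>i\<close>, since \<open>a \<le> \<delta>\<^sub>i\<close> is the
  wrong direction; instead \<open>a\<close>, being idempotent, lies in its own stabilizer, so \<open>a\<^sub>i = 1\<close>.
\<close>

lemma CCE_with_cofactor_stabilizer:
  assumes i: "i \<in> I" and a: "a \<in> CCE P"
    and Stab: "Stab P a = proj i -` {\<one>\<^bsub>M i\<^esub>} \<inter> carrier P"
  shows "a = delta I M i"
proof -
  \<comment> \<open>Coordinate \<open>i\<close> of \<open>delta I M i\<close> is one, so it
    stabilizes \<open>a\<close>; hence \<open>a\<close> vanishes off \<open>i\<close>.\<close>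
  have "delta I M i \<in> Stab P a"
    unfolding Stab using i P.CCE_closed[OF delta_CCE[OF i]] by (simp add: proj_def delta_def)
  then have "a = embed0 i (a i)"
    using le_delta_iff[OF i P.CCE_closed[OF a]] unfolding Stab_def by blast
  moreover have "a \<in> Stab P a"
    using a P.CE_idem P.CCE_closed[OF a] unfolding Stab_def CCE_def by blast
  then have "a i = \<one>\<^bsub>M i\<^esub>"
    unfolding Stab by (simp add: proj_def)
  ultimately show ?thesis
    unfolding delta_eq_embed0 by metis
qed

lemma factors_eq_stabilizers_iff:
  "{iota I M i ` carrier (M i) | i. i \<in> I} = {Stab P e | e. e \<in> coatoms (CCE_poset P)} \<longleftrightarrow>
    (\<forall>i\<in>I. CCE (M i) = {mzero (M i), \<one>\<^bsub>M i\<^esub>})" (is "?F = ?S \<longleftrightarrow> ?triv")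
proof
  assume eq: "?F = ?S"
  show ?triv
  proof
    fix i assume i: "i \<in> I"
    then have "iota I M i ` carrier (M i) \<in> ?S"
      unfolding eq[symmetric] by blast
    \<comment> \<open>A coatom whose stabilizer is the factor at \<open>i\<close> can only be
      \<open>eps I M i\<close>, so \<open>eps I M i\<close> is itself a coatom.\<close>
    then obtain c where c: "c \<in> coatoms (CCE_poset P)" "Stab P c = iota I M i ` carrier (M i)"
      by auto
    then show "CCE (M i) = {mzero (M i), \<one>\<^bsub>M i\<^esub>}"
      using coatom_with_factor_stabilizer[OF i c] eps_coatom_iff[OF i] by simp
  qed
next
  assume ?triv
  then have "?S = {Stab P (eps I M i) | i. i \<in> I}"
    using coatoms_eq_iff by auto
  also have "\<dots> = ?F"
    using Stab_eps by (intro Collect_cong) metis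
  finally show "?F = ?S" by simp
qed

lemma cofactors_eq_stabilizers_iff:
  "{proj i -` {\<one>\<^bsub>M i\<^esub>} \<inter> carrier P | i. i \<in> I} = {Stab P e | e. e \<in> atoms (CCE_poset P)} \<longleftrightarrow>
    (\<forall>i\<in>I. CCE (M i) = {mzero (M i), \<one>\<^bsub>M i\<^esub>})" (is "?F = ?S \<longleftrightarrow> ?triv")
proof
  assume eq: "?F = ?S"
  show ?triv
  proof
    fix i assume i: "i \<in> I"
    then have "proj i -` {\<one>\<^bsub>M i\<^esub>} \<inter> carrier P \<in> ?S"
      unfolding eq[symmetric] by blast
    then obtain a where a: "a \<in> atoms (CCE_poset P)"
        "Stab P a = proj i -` {\<one>\<^bsub>M i\<^esub>} \<inter> carrier P"
      by auto
    then have "a \<in> CCE P"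
      unfolding P.mem_atoms_CCE_iff by blast
    then show "CCE (M i) = {mzero (M i), \<one>\<^bsub>M i\<^esub>}"
      using CCE_with_cofactor_stabilizer[OF i _ a(2)] a(1) delta_atom_iff[OF i] by simp
  qed
next
  assume ?triv
  then have "?S = {Stab P (delta I M i) | i. i \<in> I}"
    using atoms_eq_iff by auto
  also have "\<dots> = ?F"
    using Stab_delta by (intro Collect_cong) metis
  finally show "?F = ?S" by simp
qed

end

theorem proposition2p12:
  fixes I :: "'i set" and M :: "'i \<Rightarrow> ('a, 'm) monoid_scheme"
  assumes "\<And>i. i \<in> I \<Longrightarrow> nontrivial_monoid_with_zero (M i)"
  shows "all_equivalent
    [\<forall>i\<in>I. CCE (M i) = {mzero (M i), \<one>\<^bsub>M i\<^esub>},
     coatoms (CCE_poset (product_monoid I M)) = {eps I M i | i. i \<in> I},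
     {iota I M i ` carrier (M i) | i. i \<in> I}
       = {Stab (product_monoid I M) e | e. e \<in> coatoms (CCE_poset (product_monoid I M))},
     atoms (CCE_poset (product_monoid I M)) = {delta I M i | i. i \<in> I},
     {proj i -` {\<one>\<^bsub>M i\<^esub>} \<inter> carrier (product_monoid I M) | i. i \<in> I}
       = {Stab (product_monoid I M) e | e. e \<in> atoms (CCE_poset (product_monoid I M))}]"
proof -
  interpret nontrivial_monoids_with_zero I M
    using assms by (rule nontrivial_monoids_with_zero.intro)
  show ?thesis
    \<comment> \<open>Each of the last four conditions is rewritten to the first, so the list
      becomes five copies of one proposition.\<close>
    unfolding all_equivalent_def coatoms_eq_iff factors_eq_stabilizers_iff atoms_eq_iff
      cofactors_eq_stabilizers_iff
    by simp
qed

end
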